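(* Let $R$ be an aperiodic two-step rule. For each step direction $\theta\in\{e,n,w,s\}$ the quarter-plane generating function $Q_\theta$ satisfies an equation of the form $$Q_\theta(x,y)=L_\theta(x,y)+B_\theta(x,y)Q_\theta(x,y)-D_\theta(x,y)Q^{\downarrow}(x)-J_\theta(x,y)Q^{\leftarrow}(y),$$ where - $B_\theta$ is the generating function of walks (in the full plane) obeying $R$ which start with a step that can follow $\theta$ and contain no $\theta$ steps except for their last step, which is $\theta$; - $L_\theta$ is the generating function of walks (in the full plane) obeying $R$ which start with an east or north step and contain no $\theta$ steps except for their last step, which is $\theta$; - $D_\theta$ is the generating function of walks (in the full plane) obeying $R$ which start with a south step and contain no $\theta$ steps except for their last step, which is $\theta$; - $J_\theta$ is the generating function of walks (in the full plane) obeying $R$ which start with a west step and contain no $\theta$ steps except for their last step, which is $\theta$; - $Q^{\downarrow}(x)$ is the generating function of walks in the quarter plane obeying $R$ which end on the $\mathbf x$-axis with a step type that can precede south; and - $Q^{\leftarrow}(y)$ is the generating function of walks in the quarter plane obeying $R$ which end on the $\mathbf y$-axis with a step type that can precede west.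
   Context: Steps on $\mathbb Z^2$: east $(1,0)$, north $(0,1)$, west $(-1,0)$, south $(0,-1)$, abbreviated $e,n,w,s$. A two-step rule is a map $R:\{e,n,w,s\}^2\to\{0,1\}$; $R(i,j)=1$ means a step of type $i$ may be immediately followed by one of type $j$ (then $j$ can follow $i$, and $i$ can precede $j$). Its transfer matrix is $T=(R(i,j))_{i,j}$. The rule is aperiodic if there is $k\ge1$ with $(T^k)_{ij}>0$ for all $i,j$. A walk obeying $R$ is a nonempty finite sequence of steps, starting at the origin, with arbitrary first step and with $R(i,j)=1$ for each consecutive pair of steps $(i,j)$. The generating function of a class of walks is $\sum t^m x^a y^b$ over walks in the class, where $m$ is the length and $(a,b)$ the endpoint (the walk starting at the origin). $Q_\theta(x,y)\equiv Q_\theta(t;x,y)$ is the generating function of walks obeying $R$, starting at the origin, staying in the quarter plane $\{(a,b):a\ge0,\ b\ge0\}$, whose last step is $\theta$. *)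

theory Defs
  imports
    "HOL-Analysis.Finite_Cartesian_Product"
    "HOL-Computational_Algebra.Formal_Power_Series"
    "HOL-Library.Poly_Mapping"
    "HOL-Library.Product_Plus"
begin

datatype step = East | North | West | South

lemma UNIV_step: "(UNIV :: step set) = {East, North, West, South}"
  by (auto intro: step.exhaust)

instance step :: finite
  by standard (simp add: UNIV_step)

fun step_vec :: "step \<Rightarrow> int \<times> int" where
  "step_vec East = (1, 0)"
| "step_vec North = (0, 1)"
| "step_vec West = (-1, 0)"
| "step_vec South = (0, -1)"

type_synonym rule = "step \<Rightarrow> step \<Rightarrow> bool"

definition transfer_matrix :: "rule \<Rightarrow> nat^step^step" where
  "transfer_matrix R = (\<chi> i j. of_bool (R i j))"

definition aperiodic :: "rule \<Rightarrow> bool" where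
  "aperiodic R \<longleftrightarrow>
     (\<exists>k\<ge>1. \<forall>i j. (((**) (transfer_matrix R) ^^ k) (mat 1)) $ i $ j > 0)"

definition endpoint :: "step list \<Rightarrow> int \<times> int" where
  "endpoint w = sum_list (map step_vec w)"

definition walks :: "rule \<Rightarrow> step list set" where
  "walks R = {w. w \<noteq> [] \<and> successively R w}"

definition quarter_plane :: "(int \<times> int) set" where
  "quarter_plane = {(a, b). a \<ge> 0 \<and> b \<ge> 0}"

definition quarter_walks :: "rule \<Rightarrow> step list set" where
  "quarter_walks R =
     {w \<in> walks R. \<forall>k\<le>length w. endpoint (take k w) \<in> quarter_plane}"

definition first_hit_walks :: "rule \<Rightarrow> step \<Rightarrow> step list set" where
  "first_hit_walks R \<theta> = {w \<in> walks R. last w = \<theta> \<and> \<theta> \<notin> set (butlast w)}"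

text \<open>
  Generating functions are power series in \<open>t\<close> whose coefficients are Laurent polynomials
  in \<open>x\<close> and \<open>y\<close> with integer coefficients. A Laurent polynomial is a finitely supported
  function on the exponents \<open>(a, b)\<close>, multiplied by convolution, so that
  \<^term>\<open>Poly_Mapping.single (a, b) 1\<close> is the monomial with exponent \<open>a\<close> of \<open>x\<close> and
  \<open>b\<close> of \<open>y\<close>.
\<close>

type_synonym laurent_xy = "(int \<times> int) \<Rightarrow>\<^sub>0 int"

lemma finite_steps_of_length: "finite {w \<in> C. length (w :: step list) = m}"
  by (rule finite_subset[OF _ finite_lists_length_eq[of UNIV m]]) auto

definition gen_fun :: "step list set \<Rightarrow> laurent_xy fps" where
  "gen_fun C =
     Abs_fps (\<lambda>m. \<Sum>w\<in>{w \<in> C. length w = m}. Poly_Mapping.single (endpoint w) 1)"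

definition Q :: "rule \<Rightarrow> step \<Rightarrow> laurent_xy fps" where
  "Q R \<theta> = gen_fun {w \<in> quarter_walks R. last w = \<theta>}"

definition B :: "rule \<Rightarrow> step \<Rightarrow> laurent_xy fps" where
  "B R \<theta> = gen_fun {w \<in> first_hit_walks R \<theta>. R \<theta> (hd w)}"

definition L :: "rule \<Rightarrow> step \<Rightarrow> laurent_xy fps" where
  "L R \<theta> = gen_fun {w \<in> first_hit_walks R \<theta>. hd w = East \<or> hd w = North}"

definition D :: "rule \<Rightarrow> step \<Rightarrow> laurent_xy fps" where
  "D R \<theta> = gen_fun {w \<in> first_hit_walks R \<theta>. hd w = South}"

definition J :: "rule \<Rightarrow> step \<Rightarrow> laurent_xy fps" where
  "J R \<theta> = gen_fun {w \<in> first_hit_walks R \<theta>. hd w = West}"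

text \<open>
  The following two series involve only \<open>x\<close>, respectively only \<open>y\<close>, because the other
  coordinate of every contributing endpoint is 0.
\<close>

definition Q_down :: "rule \<Rightarrow> laurent_xy fps" where
  "Q_down R = gen_fun {w \<in> quarter_walks R. snd (endpoint w) = 0 \<and> R (last w) South}"

definition Q_left :: "rule \<Rightarrow> laurent_xy fps" where
  "Q_left R = gen_fun {w \<in> quarter_walks R. fst (endpoint w) = 0 \<and> R (last w) West}"

end

theory Submission
  imports Defs
begin

text \<open>
  The equation counts one set of full-plane walks in two ways. Consider the walks with last step
  \<open>\<theta>\<close> and first step east or north that do not leave the quarter plane up to and including
  their last-but-one \<open>\<theta>\<close> step, if there is one; after that step they are free to leave.

  Cutting such a walk right after its last-but-one \<open>\<theta>\<close> yields a quarter-plane walk ending in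
  \<open>\<theta>\<close> followed by a walk counted by \<open>B\<close>; if there is only one \<open>\<theta>\<close>, the whole walk is
  counted by \<open>L\<close>. This gives \<open>L + B Q\<close>. On the other hand, such a walk either stays in the
  quarter plane, which is counted by \<open>Q\<close>, or it can be cut right before the step that leaves the
  quarter plane for the first time. That step is a south step from the x-axis or a west step from
  the y-axis, and everything from it on contains \<open>\<theta>\<close> only at the end, which gives
  \<open>D Q_down + J Q_left\<close>. Conversely, a quarter-plane walk followed by an exit and a first visit
  to \<open>\<theta>\<close> has all its earlier \<open>\<theta>\<close> steps inside the quarter plane.

  The set identity is \<open>last_visit_first_exit\<close>. Passing to generating functions requires
  that concatenation is injective for both ways of cutting (\<open>first_hit_cut_unique\<close> and
  \<open>exit_cut_unique\<close>).
\<close>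


section \<open>Generating functions of unions and concatenations\<close>

definition concats :: "(step list \<times> step list) set \<Rightarrow> step list set" where
  "concats P = (\<lambda>(p, w). p @ w) ` P"

lemma concatsI: "(p, w) \<in> P \<Longrightarrow> p @ w \<in> concats P"
  by (force simp: concats_def)

lemma concatsE:
  assumes "u \<in> concats P"
  obtains p w where "(p, w) \<in> P" "u = p @ w"
  using assms by (auto simp: concats_def)

lemma concats_Un: "concats (P \<union> P') = concats P \<union> concats P'"
  by (simp add: concats_def image_Un)

lemma endpoint_append: "endpoint (u @ v) = endpoint u + endpoint v"
  by (simp add: endpoint_def)

lemma gen_fun_Un_disjoint:
  assumes "X \<inter> Y = {}"
  shows "gen_fun (X \<union> Y) = gen_fun X + gen_fun Y"
proof (rule fps_ext)
  fix m
  have "{w \<in> X \<union> Y. length w = m} = {w \<in> X. length w = m} \<union> {w \<in> Y. length w = m}"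
    by auto
  then show "fps_nth (gen_fun (X \<union> Y)) m = fps_nth (gen_fun X + gen_fun Y) m"
    using assms by (auto simp: gen_fun_def finite_steps_of_length intro!: sum.union_disjoint)
qed

text \<open>
  Lengths and endpoints add under concatenation, so a coefficient of the product is a sum over
  pairs of walks; injectivity says that this counts no concatenation twice.
\<close>

lemma gen_fun_concats_times:
  assumes inj: "inj_on (\<lambda>(p, w). p @ w) (X \<times> Y)"
  shows "gen_fun (concats (X \<times> Y)) = gen_fun X * gen_fun Y"
proof (rule fps_ext)
  fix m
  let ?X = "\<lambda>i. {w \<in> X. length w = i}"
  let ?Y = "\<lambda>i. {w \<in> Y. length w = i}"
  let ?mon = "\<lambda>w. Poly_Mapping.single (endpoint w) (1 :: int)"
  let ?S = "SIGMA i:{0..m}. ?X i \<times> ?Y (m - i)"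
  have "fps_nth (gen_fun X * gen_fun Y) m
      = (\<Sum>i = 0..m. (\<Sum>p\<in>?X i. ?mon p) * (\<Sum>w\<in>?Y (m - i). ?mon w))"
    by (simp add: fps_mult_nth gen_fun_def)
  also have "\<dots> = (\<Sum>i = 0..m. \<Sum>(p, w)\<in>?X i \<times> ?Y (m - i). ?mon (p @ w))"
    by (simp add: sum_product sum.cartesian_product mult_single endpoint_append)
  also have "\<dots> = (\<Sum>(i, p, w)\<in>?S. ?mon (p @ w))"
    by (subst sum.Sigma) (auto simp: finite_steps_of_length split_def)
  also have "\<dots> = (\<Sum>u\<in>{u \<in> concats (X \<times> Y). length u = m}. ?mon u)"
  proof (rule sum.reindex_cong[symmetric])
    show "inj_on (\<lambda>(i, p, w). p @ w) ?S"
    proof (rule inj_onI)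
      fix a b
      assume "a \<in> ?S" "b \<in> ?S" "(\<lambda>(i, p, w). p @ w) a = (\<lambda>(i, p, w). p @ w) b"
      then show "a = b"
        using inj_onD[OF inj, of "snd a" "snd b"] by auto
    qed
    show "{u \<in> concats (X \<times> Y). length u = m} = (\<lambda>(i, p, w). p @ w) ` ?S"
      by (force simp: concats_def image_iff)
  qed auto
  finally show "fps_nth (gen_fun (concats (X \<times> Y))) m = fps_nth (gen_fun X * gen_fun Y) m"
    by (simp add: gen_fun_def)
qed


section \<open>Walks in the quarter plane and their first exit\<close>

lemma walks_append:
  "p \<noteq> [] \<Longrightarrow> w \<noteq> [] \<Longrightarrow>
    p @ w \<in> walks R \<longleftrightarrow> p \<in> walks R \<and> w \<in> walks R \<and> R (last p) (hd w)"
  by (auto simp: walks_def successively_append_iff)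

lemma quarter_walks_not_Nil: "w \<in> quarter_walks R \<Longrightarrow> w \<noteq> []"
  by (auto simp: quarter_walks_def walks_def)

lemma quarter_walks_walks: "w \<in> quarter_walks R \<Longrightarrow> w \<in> walks R"
  by (auto simp: quarter_walks_def)

lemma quarter_walks_endpoint: "w \<in> quarter_walks R \<Longrightarrow> endpoint w \<in> quarter_plane"
  by (auto simp: quarter_walks_def dest: spec[of _ "length w"])

lemma quarter_walks_prefix:
  assumes "p @ w \<in> quarter_walks R" "p \<noteq> []"
  shows "p \<in> quarter_walks R"
proof -
  have "endpoint (take k p) \<in> quarter_plane" if "k \<le> length p" for k
    using assms that by (auto simp: quarter_walks_def dest: spec[of _ k])
  then show ?thesis
    using assms by (auto simp: quarter_walks_def walks_def successively_append_iff)
qed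

lemma quarter_walks_snoc:
  assumes "p \<in> quarter_walks R" "p @ [s] \<in> walks R" "endpoint (p @ [s]) \<in> quarter_plane"
  shows "p @ [s] \<in> quarter_walks R"
  using assms by (auto simp: quarter_walks_def le_Suc_eq)

lemma quarter_walks_singleton: "[s] \<in> quarter_walks R \<longleftrightarrow> s = East \<or> s = North"
  by (cases s)
     (auto simp: quarter_walks_def walks_def endpoint_def quarter_plane_def le_Suc_eq zero_prod_def)

lemma quarter_walks_hd:
  assumes "w \<in> quarter_walks R"
  shows "hd w = East \<or> hd w = North"
proof -
  have "[hd w] @ tl w \<in> quarter_walks R"
    using assms quarter_walks_not_Nil by force
  then show ?thesis
    using quarter_walks_prefix[of "[hd w]"] quarter_walks_singleton by blast
qed

lemma exit_step_iff:
  assumes "endpoint p \<in> quarter_plane"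
  shows "endpoint (p @ [s]) \<in> quarter_plane \<longleftrightarrow>
    \<not> (s = South \<and> snd (endpoint p) = 0 \<or> s = West \<and> fst (endpoint p) = 0)"
  using assms
  by (cases s; cases "endpoint p") (auto simp: endpoint_def quarter_plane_def)

lemma first_exit:
  assumes "u \<in> walks R" "hd u = East \<or> hd u = North" "u \<notin> quarter_walks R"
  obtains p s r where "u = p @ s # r" "p \<in> quarter_walks R" "endpoint (p @ [s]) \<notin> quarter_plane"
proof -
  have "\<exists>p s r. u = p @ s # r \<and> p \<in> quarter_walks R \<and> endpoint (p @ [s]) \<notin> quarter_plane"
    using assms
  proof (induction u rule: rev_induct)
    case Nil
    then show ?case by (simp add: walks_def)
  next
    case (snoc s v)
    have "v \<noteq> []"
      using snoc.prems quarter_walks_singleton by auto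
    show ?case
    proof (cases "v \<in> quarter_walks R")
      case True
      then show ?thesis
        using snoc.prems quarter_walks_snoc by blast
    next
      case False
      then obtain p s' r where "v = p @ s' # r" "p \<in> quarter_walks R"
        "endpoint (p @ [s']) \<notin> quarter_plane"
        using snoc \<open>v \<noteq> []\<close> by (auto simp: walks_append)
      then show ?thesis by auto
    qed
  qed
  then show ?thesis using that by blast
qed

text \<open>
  A quarter-plane prefix of a walk cannot reach past a step that leaves the quarter plane. This
  is what makes the first exit unique.
\<close>

lemma quarter_prefix_before_exit:
  assumes "p @ w = p' @ w'" "p \<in> quarter_walks R" "w' \<noteq> []"
    and "endpoint (p' @ [hd w']) \<notin> quarter_plane"
  obtains q where "p' = p @ q" "w = q @ w'"
proof -
  have False if "p = p' @ q" "w' = q @ w" "q \<noteq> []" for q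
  proof -
    have "p = (p' @ [hd w']) @ tl q"
      using that by simp
    then have "p' @ [hd w'] \<in> quarter_walks R"
      using quarter_walks_prefix assms(2) by blast
    then show False
      using assms(4) quarter_walks_endpoint by blast
  qed
  moreover obtain q where "p = p' @ q \<and> q @ w = w' \<or> p @ q = p' \<and> w = q @ w'"
    using assms(1) by (auto simp: append_eq_append_conv2)
  ultimately show ?thesis
    using that by (cases "q = []") auto
qed

lemma exit_cut_unique:
  assumes "p @ w = p' @ w'" "p \<in> quarter_walks R" "p' \<in> quarter_walks R" "w \<noteq> []" "w' \<noteq> []"
    and "endpoint (p @ [hd w]) \<notin> quarter_plane" "endpoint (p' @ [hd w']) \<notin> quarter_plane"
  shows "p = p' \<and> w = w'"
proof -
  obtain q where "p' = p @ q"
    using quarter_prefix_before_exit assms by metis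
  moreover obtain q' where "p = p' @ q'"
    using quarter_prefix_before_exit assms by metis
  ultimately show ?thesis using assms(1) by simp
qed


section \<open>First visits\<close>

lemma first_hit_walks_not_Nil: "w \<in> first_hit_walks R \<theta> \<Longrightarrow> w \<noteq> []"
  by (auto simp: first_hit_walks_def walks_def)

lemma first_hit_walks_suffix:
  "q @ w \<in> first_hit_walks R \<theta> \<Longrightarrow> w \<noteq> [] \<Longrightarrow> w \<in> first_hit_walks R \<theta>"
  by (auto simp: first_hit_walks_def walks_def successively_append_iff butlast_append)

lemma first_hit_walks_append:
  "w \<in> first_hit_walks R \<theta> \<Longrightarrow> q @ w \<in> walks R \<Longrightarrow> \<theta> \<notin> set q \<Longrightarrow> q @ w \<in> first_hit_walks R \<theta>"
  by (auto simp: first_hit_walks_def walks_def butlast_append)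

text \<open>
  Of two different cuts right after a \<open>\<theta>\<close> step, the earlier one would leave the \<open>\<theta>\<close> of the
  later one in its second part, before the end.
\<close>

lemma first_hit_cut_unique:
  assumes "p @ w = p' @ w'" "last p = \<theta>" "last p' = \<theta>"
    and w: "w \<in> first_hit_walks R \<theta>" and w': "w' \<in> first_hit_walks R \<theta>"
  shows "p = p' \<and> w = w'"
proof -
  have *: "q = []"
    if "last (a @ q) = \<theta>" "q @ v \<in> first_hit_walks R \<theta>" "v \<noteq> []" for a q v
    using that by (cases q rule: rev_cases) (auto simp: first_hit_walks_def butlast_append)
  obtain q where "p = p' @ q \<and> q @ w = w' \<or> p @ q = p' \<and> w = q @ w'"
    using assms(1) by (auto simp: append_eq_append_conv2)
  moreover from this have "q = []"
    using *[of p' q w] *[of p q w'] assms first_hit_walks_not_Nil by metis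
  ultimately show ?thesis by auto
qed


section \<open>The two decompositions\<close>

text \<open>
  Both exits, through the x-axis and through the y-axis, are kept in one set: uniqueness of the
  first exit then gives injectivity within each kind and disjointness of the two kinds together.
\<close>

definition exit_pairs :: "rule \<Rightarrow> step \<Rightarrow> (step list \<times> step list) set" where
  "exit_pairs R \<theta> = {(p, w). p \<in> quarter_walks R \<and> w \<in> first_hit_walks R \<theta> \<and>
     R (last p) (hd w) \<and> endpoint (p @ [hd w]) \<notin> quarter_plane}"

definition return_pairs :: "rule \<Rightarrow> step \<Rightarrow> (step list \<times> step list) set" where
  "return_pairs R \<theta> =
     {p \<in> quarter_walks R. last p = \<theta>} \<times> {w \<in> first_hit_walks R \<theta>. R \<theta> (hd w)}"

lemma exit_pairs_eq:
  "exit_pairs R \<theta> =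
     {p \<in> quarter_walks R. snd (endpoint p) = 0 \<and> R (last p) South} \<times>
       {w \<in> first_hit_walks R \<theta>. hd w = South} \<union>
     {p \<in> quarter_walks R. fst (endpoint p) = 0 \<and> R (last p) West} \<times>
       {w \<in> first_hit_walks R \<theta>. hd w = West}"
  unfolding exit_pairs_def
  by (auto simp: exit_step_iff[OF quarter_walks_endpoint])

lemma inj_on_exit_pairs: "inj_on (\<lambda>(p, w). p @ w) (exit_pairs R \<theta>)"
proof (rule inj_onI, clarify)
  fix p w p' w'
  assume "(p, w) \<in> exit_pairs R \<theta>" "(p', w') \<in> exit_pairs R \<theta>" "p @ w = p' @ w'"
  then show "p = p' \<and> w = w'"
    using first_hit_walks_not_Nil by (intro exit_cut_unique) (auto simp: exit_pairs_def)
qed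

lemma inj_on_return_pairs: "inj_on (\<lambda>(p, w). p @ w) (return_pairs R \<theta>)"
proof (rule inj_onI, clarify)
  fix p w p' w'
  assume "(p, w) \<in> return_pairs R \<theta>" "(p', w') \<in> return_pairs R \<theta>" "p @ w = p' @ w'"
  then show "p = p' \<and> w = w'"
    by (intro first_hit_cut_unique) (auto simp: return_pairs_def)
qed

lemma quarter_walks_exit_disjoint: "quarter_walks R \<inter> concats (exit_pairs R \<theta>) = {}"
proof -
  have False if "(p, w) \<in> exit_pairs R \<theta>" and pw: "p @ w \<in> quarter_walks R" for p w
  proof -
    have w: "w \<noteq> []" "endpoint (p @ [hd w]) \<notin> quarter_plane"
      using that first_hit_walks_not_Nil by (auto simp: exit_pairs_def)
    then obtain q where "p = (p @ w) @ q"
      using quarter_prefix_before_exit[of "p @ w" "[]" p w R] pw by auto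
    then show False using w(1) by simp
  qed
  then show ?thesis by (auto elim!: concatsE)
qed

lemma first_hit_return_disjoint: "first_hit_walks R \<theta> \<inter> concats (return_pairs R \<theta>) = {}"
proof -
  have False if "(p, w) \<in> return_pairs R \<theta>" "p @ w \<in> first_hit_walks R \<theta>" for p w
  proof -
    have p: "p \<noteq> []" "last p = \<theta>" and "w \<noteq> []"
      using that quarter_walks_not_Nil[of p R] first_hit_walks_not_Nil[of w R \<theta>]
      by (auto simp: return_pairs_def)
    from p have "\<theta> \<in> set p"
      using last_in_set by blast
    with \<open>w \<noteq> []\<close> show False
      using that(2) by (auto simp: first_hit_walks_def butlast_append)
  qed
  then show ?thesis by (auto elim!: concatsE)
qed

text \<open>
  Each inclusion compares the two cuts of the same walk. If the walk leaves the quarter plane, its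
  first exit comes after the last-but-one \<open>\<theta>\<close>, because the part up to that \<open>\<theta>\<close> stays inside;
  so the part from the exit on is again a first visit to \<open>\<theta>\<close>. Conversely, if the part from the
  exit on is a first visit, the last-but-one \<open>\<theta>\<close> lies before the exit.
\<close>

lemma last_visit_first_exit:
  "{w \<in> first_hit_walks R \<theta>. hd w = East \<or> hd w = North} \<union> concats (return_pairs R \<theta>) =
   {w \<in> quarter_walks R. last w = \<theta>} \<union> concats (exit_pairs R \<theta>)"
  (is "?F \<union> ?BQ = ?Q \<union> ?E")
proof (intro equalityI subsetI)
  fix u assume u: "u \<in> ?F \<union> ?BQ"
  \<comment> \<open>Both kinds of walks are treated at once: \<open>p\<close> is empty for a walk with a single \<open>\<theta>\<close>.\<close>
  obtain p w where pw: "u = p @ w" "p = [] \<or> p \<in> quarter_walks R" "w \<in> first_hit_walks R \<theta>"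
    and walk: "u \<in> walks R" and hd: "hd u = East \<or> hd u = North"
  proof (cases "u \<in> ?F")
    case True
    then show ?thesis using that[of "[]" u] by (auto simp: first_hit_walks_def)
  next
    case False
    then obtain p w where "u = p @ w" "(p, w) \<in> return_pairs R \<theta>"
      using u by (auto elim: concatsE)
    then show ?thesis
      using that[of p w] quarter_walks_hd[of p R] quarter_walks_not_Nil[of p R]
        quarter_walks_walks[of p R] first_hit_walks_not_Nil[of w R]
      by (auto simp: return_pairs_def walks_append first_hit_walks_def)
  qed
  show "u \<in> ?Q \<union> ?E"
  proof (cases "u \<in> quarter_walks R")
    case True
    then show ?thesis
      using pw first_hit_walks_not_Nil by (auto simp: first_hit_walks_def)
  next
    case False
    then obtain p' s r where u': "u = p' @ s # r" and p': "p' \<in> quarter_walks R"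
      and exit: "endpoint (p' @ [s]) \<notin> quarter_plane"
      using first_exit walk hd by blast
    have "\<exists>q. w = q @ s # r"
    proof (cases "p = []")
      case True
      then show ?thesis using pw(1) u' by auto
    next
      case False
      then show ?thesis
        using quarter_prefix_before_exit[of p w p' "s # r" R] pw u' exit by auto
    qed
    then have "s # r \<in> first_hit_walks R \<theta>"
      using first_hit_walks_suffix pw(3) by blast
    moreover have "R (last p') s"
      using walk p' quarter_walks_not_Nil[of p' R] by (simp add: u' walks_append)
    ultimately have "(p', s # r) \<in> exit_pairs R \<theta>"
      using p' exit by (simp add: exit_pairs_def)
    then show ?thesis using u' concatsI by blast
  qed
next
  fix u assume u: "u \<in> ?Q \<union> ?E"
  \<comment> \<open>A walk that stays in the quarter plane is cut before its last step, so that in both cases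
    every \<open>\<theta>\<close> other than the final one lies in \<open>p\<close>.\<close>
  obtain p w where pw: "u = p @ w" "p = [] \<or> p \<in> quarter_walks R" "w \<in> first_hit_walks R \<theta>"
    and walk: "u \<in> walks R" and hd: "hd u = East \<or> hd u = North"
  proof (cases "u \<in> ?Q")
    case True
    then have "u = butlast u @ [\<theta>]"
      using quarter_walks_not_Nil append_butlast_last_id by force
    then show ?thesis
      using that[of "butlast u" "[\<theta>]"] True quarter_walks_hd quarter_walks_walks
        quarter_walks_prefix[of "butlast u" "[\<theta>]" R]
      by (auto simp: first_hit_walks_def walks_def)
  next
    case False
    then obtain p w where "u = p @ w" "(p, w) \<in> exit_pairs R \<theta>"
      using u by (auto elim: concatsE)
    then show ?thesis
      using that[of p w] quarter_walks_hd[of p R] quarter_walks_not_Nil[of p R]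
        quarter_walks_walks[of p R] first_hit_walks_not_Nil[of w R]
      by (auto simp: exit_pairs_def walks_append first_hit_walks_def)
  qed
  show "u \<in> ?F \<union> ?BQ"
  proof (cases "\<theta> \<in> set p")
    case False
    then show ?thesis
      using first_hit_walks_append pw walk hd by auto
  next
    case True
    then obtain a b where p: "p = a @ \<theta> # b" and b: "\<theta> \<notin> set b"
      by (meson split_list_last)
    have u': "u = (a @ [\<theta>]) @ (b @ w)"
      by (simp add: pw(1) p)
    have "a @ [\<theta>] \<in> quarter_walks R"
      using quarter_walks_prefix[of "a @ [\<theta>]" b R] pw(2) p by auto
    moreover have "b @ w \<in> walks R \<and> R \<theta> (hd (b @ w))"
      using walk first_hit_walks_not_Nil[OF pw(3)]
      by (subst (asm) u', subst (asm) walks_append) auto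
    ultimately have "(a @ [\<theta>], b @ w) \<in> return_pairs R \<theta>"
      using first_hit_walks_append[OF pw(3) _ b] by (auto simp: return_pairs_def)
    then show ?thesis using u' concatsI by blast
  qed
qed


section \<open>The functional equation\<close>

lemma gen_fun_return_pairs: "gen_fun (concats (return_pairs R \<theta>)) = Q R \<theta> * B R \<theta>"
  unfolding return_pairs_def Q_def B_def
  by (rule gen_fun_concats_times) (rule inj_on_return_pairs[unfolded return_pairs_def])

lemma gen_fun_exit_pairs:
  "gen_fun (concats (exit_pairs R \<theta>)) = Q_down R * D R \<theta> + Q_left R * J R \<theta>"
proof -
  let ?down = "{p \<in> quarter_walks R. snd (endpoint p) = 0 \<and> R (last p) South} \<times>
    {w \<in> first_hit_walks R \<theta>. hd w = South}"
  let ?left = "{p \<in> quarter_walks R. fst (endpoint p) = 0 \<and> R (last p) West} \<times>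
    {w \<in> first_hit_walks R \<theta>. hd w = West}"
  have inj: "inj_on (\<lambda>(p, w). p @ w) (?down \<union> ?left)"
    using inj_on_exit_pairs unfolding exit_pairs_eq .
  have "?down \<inter> ?left = {}" by auto
  then have "concats ?down \<inter> concats ?left = {}"
    using inj_on_image_Int[OF inj, of ?down ?left] unfolding concats_def by simp
  then have "gen_fun (concats (exit_pairs R \<theta>)) = gen_fun (concats ?down) + gen_fun (concats ?left)"
    unfolding exit_pairs_eq concats_Un by (rule gen_fun_Un_disjoint)
  also have "gen_fun (concats ?down) = Q_down R * D R \<theta>"
    unfolding Q_down_def D_def
    by (rule gen_fun_concats_times) (rule inj_on_subset[OF inj Un_upper1])
  also have "gen_fun (concats ?left) = Q_left R * J R \<theta>"
    unfolding Q_left_def J_def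
    by (rule gen_fun_concats_times) (rule inj_on_subset[OF inj Un_upper2])
  finally show ?thesis .
qed

theorem theorem3:
  fixes R :: rule and \<theta> :: step
  assumes "aperiodic R"
  shows "Q R \<theta> = L R \<theta> + B R \<theta> * Q R \<theta> - D R \<theta> * Q_down R - J R \<theta> * Q_left R"
proof -
  have "L R \<theta> + Q R \<theta> * B R \<theta> =
      gen_fun ({w \<in> first_hit_walks R \<theta>. hd w = East \<or> hd w = North} \<union> concats (return_pairs R \<theta>))"
    unfolding L_def gen_fun_return_pairs[symmetric]
    by (rule gen_fun_Un_disjoint[symmetric]) (use first_hit_return_disjoint in blast)
  also have "\<dots> = Q R \<theta> + (Q_down R * D R \<theta> + Q_left R * J R \<theta>)"
    unfolding last_visit_first_exit Q_def gen_fun_exit_pairs[symmetric]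
    by (rule gen_fun_Un_disjoint) (use quarter_walks_exit_disjoint in blast)
  finally show ?thesis
    by (simp add: algebra_simps)
qed

end
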